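(* For the P\'olya urn with $d=1$ started with one red and one black ball, and every integer $t\ge 2$, $$\mathbf{P}(S_{1,1}=(t-1)/t)=\frac{2t-3}{t}H(1-(1/t))-\frac{t-2}{t}H(1-(2/t))-\frac{t-2}{t-1}$$ and $$\mathbf{P}(S_{1,1}\le (t-1)/t)=(1-(1/t))\,H(1-(1/t)).$$
   Context: P\'olya's urn with $r=b=d=1$: the urn initially contains one red and one black ball. In each draw one ball is taken uniformly at random from the urn, and this ball together with one more ball of the same color is put into the urn. $R_n$ is the number of red balls after the $n$th draw ($R_0=1$), $Z_n=R_n/(n+2)$, and $S_{1,1}=\sup_{n\ge 0}Z_n$. $H$ is the generalized harmonic number function $H(x)=\sum_{n\ge 1}\big(\frac1n-\frac1{n+x}\big)=\Psi(x+1)+\gamma$ for $x\in\mathbf{R}\setminus\{-1,-2,\ldots\}$, where $\Psi=\Gamma'/\Gamma$ is the Digamma function and $\gamma$ is Euler's constant. *)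

theory Defs
  imports "HOL-Probability.Probability"
begin

(* A colour sequence c records the successive draws: c i holds iff the ball taken in
   draw number i + 1 is red.  The urn starts with r red and b black balls, and every
   ball drawn is put back together with d more balls of its colour. *)

definition red_count :: "nat \<Rightarrow> nat \<Rightarrow> (nat \<Rightarrow> bool) \<Rightarrow> nat \<Rightarrow> nat" where
  "red_count r d c n = r + d * card {i. i < n \<and> c i}"

definition red_proportion :: "nat \<Rightarrow> nat \<Rightarrow> nat \<Rightarrow> (nat \<Rightarrow> bool) \<Rightarrow> nat \<Rightarrow> real" where
  "red_proportion r b d c n = real (red_count r d c n) / real (r + b + n * d)"

(* The law of the draws X: given the colours c 0, ..., c (n - 1) of the first n draws, the
   next ball is uniform on the urn, hence red with conditional probability equal to the
   current proportion of red balls.  The multiplied-out form also covers histories of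
   probability 0; the conditional probability of black follows by taking complements. *)

locale polya_urn = prob_space M for M :: "'a measure" +
  fixes r b d :: nat
    and X :: "nat \<Rightarrow> 'a \<Rightarrow> bool"
  assumes measurable_draw: "\<And>n. X n \<in> measurable M (count_space UNIV)"
    and draw_red: "\<And>n c. prob {\<omega> \<in> space M. (\<forall>i<n. X i \<omega> = c i) \<and> X n \<omega>} =
                     red_proportion r b d c n * prob {\<omega> \<in> space M. \<forall>i<n. X i \<omega> = c i}"
begin

definition R :: "nat \<Rightarrow> 'a \<Rightarrow> nat" where
  "R n \<omega> = red_count r d (\<lambda>i. X i \<omega>) n"

definition Z :: "nat \<Rightarrow> 'a \<Rightarrow> real" where
  "Z n \<omega> = real (R n \<omega>) / real (r + b + n * d)"

definition S :: "'a \<Rightarrow> real" where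
  "S \<omega> = (SUP n. Z n \<omega>)"

end

definition gen_harm :: "real \<Rightarrow> real" where
  "gen_harm x = (\<Sum>n. 1 / real (Suc n) - 1 / (real (Suc n) + x))"

lemma gen_harm_eq_Digamma: "gen_harm x = Digamma (x + 1) + euler_mascheroni"
  by (simp add: gen_harm_def Digamma_def inverse_eq_divide add_ac)

end

theory Submission
  imports Defs
begin

text \<open>Put \<open>s = t - 1\<close> and follow the \<^emph>\<open>slack\<close>: \<open>s\<close> times the number of black balls minus the number
  of red balls. It starts at \<open>s - 1\<close>, a red draw lowers it by 1 and a black draw raises it by \<open>s\<close>.
  The proportion of red balls is above, equal to or below \<open>(t - 1) / t\<close> according to whether the slack
  is negative, zero or positive. Since the slack never jumps down by more than 1, the
  proportion exceeds \<open>(t - 1) / t\<close> at some time iff the slack hits \<open>-1\<close>, and it is always strictly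
  smaller iff the slack never hits \<open>0\<close> (lemma \<open>slack_hits_iff\<close>).

  Both hitting probabilities have a closed form. To fall by \<open>j\<close> with \<open>k\<close> black draws takes exactly
  \<open>n = t * k + j\<close> draws, and by the hitting time theorem \<open>j / n * (n choose k)\<close> sequences of colours do
  so for the first time at the last draw (lemma \<open>first_passage_count_rec\<close>). By exchangeability each of them has the same probability
  \<open>k! (n - k)! / (n + 1)!\<close>. The product is \<open>j / (n * (n + 1))\<close>, a difference \<open>j / n - j / (n + 1)\<close>, and
  its sum over \<open>k\<close> is a difference of two values of the series \<open>H\<close> (lemma \<open>prob_hit\<close>). The
  complement for \<open>j = s\<close> yields the distribution function of the supremum at \<open>(t - 1) / t\<close>, and the one
  for \<open>j = s - 1\<close> the probability that the proportion always stays strictly below \<open>(t - 1) / t\<close>. (If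
  \<open>t = 2\<close>, the latter is 0, as the slack starts at 0.)

  The point probability is the difference of these two numbers, once it is known that a supremum
  equal to \<open>x\<close> is almost surely attained (lemma \<open>prob_SUP_unattained\<close>). If it is not attained,
  the proportion stays below \<open>x\<close> but reaches \<open>x - e\<close> at arbitrarily late times. After a time
  \<open>\<ge> N\<close> it is unlikely to drop by \<open>e\<close> again, because the variance of its future values
  is at most \<open>1 / (N + 2)\<close>. So at every much later time \<open>m\<close> it lies in the interval from \<open>x - 2 * e\<close>
  to \<open>x\<close>, up to a small probability; and as the number of red draws is uniform on \<open>{0..m}\<close>, that
  has probability about \<open>2 * e\<close>.

  Each probability is computed conditionally on an initial piece of the history, by induction on the
  number of draws still to come: the next draw splits the history into a red and a black one.\<close>

section \<open>The slack of a colour sequence\<close>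

definition red_draws :: "(nat \<Rightarrow> bool) \<Rightarrow> nat \<Rightarrow> nat" where
  "red_draws c n = card {i. i < n \<and> c i}"

lemma red_draws_0 [simp]: "red_draws c 0 = 0"
  by (simp add: red_draws_def)

lemma red_draws_Suc [simp]: "red_draws c (Suc n) = red_draws c n + (if c n then 1 else 0)"
proof -
  have "{i. i < Suc n \<and> c i} = (if c n then insert n {i. i < n \<and> c i} else {i. i < n \<and> c i})"
    by (auto simp: less_Suc_eq)
  then show ?thesis
    by (simp add: red_draws_def)
qed

lemma red_draws_le: "red_draws c n \<le> n"
  by (induction n) auto

lemma red_draws_mono: "red_draws c m \<le> red_draws c (m + n)"
  by (induction n) auto

lemma red_draws_cong: "(\<And>i. i < n \<Longrightarrow> c i = c' i) \<Longrightarrow> red_draws c n = red_draws c' n"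
  by (induction n) auto

lemma red_draws_upd [simp]: "red_draws (c(n := x)) n = red_draws c n"
  by (rule red_draws_cong) simp

lemma red_draws_upd_Suc:
  "red_draws (c(n := x)) (Suc n) = red_draws c n + (if x then 1 else 0)"
  by simp

text \<open>After \<open>a\<close> of \<open>n\<close> draws were red, the urn holds \<open>a + 1\<close> red and \<open>n + 1 - a\<close> black balls.\<close>

definition slack :: "nat \<Rightarrow> nat \<Rightarrow> nat \<Rightarrow> int" where
  "slack s n a = int s * (int n + 1 - int a) - (int a + 1)"

lemma slack_red: "slack s (Suc n) (Suc x) = slack s n x - 1"
  by (simp add: slack_def algebra_simps)

lemma slack_black: "slack s (Suc n) x = slack s n x + int s"
  by (simp add: slack_def algebra_simps)

lemma slack_decrease_le: "slack s (m + n) (red_draws c (m + n)) \<ge> slack s m (red_draws c m) - int n"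
proof (induction n)
  case (Suc n)
  then show ?case
    using slack_red[of s "m + n" "red_draws c (m + n)"] slack_black[of s "m + n" "red_draws c (m + n)"]
    by (cases "c (m + n)") auto
qed simp

text \<open>The first time at which a walk with downward steps of size 1 is at or below a level, it is exactly
  there, provided that it starts at or above the level; the initial slack is \<open>s - 1\<close>.\<close>

lemma slack_hits_iff:
  assumes "v \<le> int s - 1"
  shows "(\<exists>n. slack s n (red_draws c n) = v) \<longleftrightarrow> (\<exists>n. slack s n (red_draws c n) \<le> v)"
proof -
  have "\<exists>i. slack s i (red_draws c i) = v" if "slack s n (red_draws c n) \<le> v" for n
    using that
  proof (induction n)
    case 0
    then show ?case using assms by (intro exI[of _ 0]) (simp add: slack_def)
  next
    case (Suc n)
    show ?case
    proof (cases "slack s n (red_draws c n) \<le> v")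
      case True
      then show ?thesis by (rule Suc.IH)
    next
      case False
      then have "slack s (Suc n) (red_draws c (Suc n)) = v"
        using Suc.prems slack_red[of s n "red_draws c n"] slack_black[of s n "red_draws c n"]
        by (cases "c n") auto
      then show ?thesis by blast
    qed
  qed
  then show ?thesis by (auto intro: eq_refl)
qed

section \<open>Counting first passages\<close>

text \<open>The probability of every single sequence of \<open>a\<close> red and \<open>b\<close> black draws.\<close>

definition path_weight :: "nat \<Rightarrow> nat \<Rightarrow> real" where
  "path_weight a b = fact a * fact b / fact (a + b + 1)"

text \<open>For \<open>n = (s + 1) * k + j\<close> this is the number of sequences of \<open>n\<close> draws, \<open>k\<close> of them black, in which
  the slack falls by \<open>j\<close> for the first time at the last draw. The value at \<open>n = 0\<close> accounts for the empty
  sequence, which reaches the level \<open>j = 0\<close>.\<close>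

definition first_passage_count :: "nat \<Rightarrow> nat \<Rightarrow> nat \<Rightarrow> real" where
  "first_passage_count j n k = (if n = 0 then 1 else real j / real n * real (n choose k))"

text \<open>The hitting time theorem as a recursion on the first draw: a red draw leaves a drop of \<open>j\<close> to be
  made, a black one uses up one of the \<open>k\<close> black draws and leaves a drop of \<open>j + 1 + s\<close>. Together with
  Pascal's rule, the identity comes down to \<open>j * (n + 1) + (s + 1) * k = (j + 1) * n\<close>.\<close>

lemma first_passage_count_rec:
  assumes n: "n = (s + 1) * k + j"
  shows "first_passage_count (Suc j) (Suc n) k =
     first_passage_count j n k + (if k = 0 then 0 else first_passage_count (j + 1 + s) n (k - 1))"
proof (cases k)
  case 0
  then show ?thesis using n by (simp add: first_passage_count_def)
next
  case (Suc k')
  have n0: "n > 0" using n Suc by simp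
  define C where "C = real (Suc n choose k)"
  have "k * (Suc n choose k) = Suc n * (n choose k')"
    using Suc_times_binomial_eq[of n k'] Suc by (simp add: mult.commute)
  then have 1: "real k * C = (real n + 1) * real (n choose k')"
    unfolding C_def by (metis of_nat_Suc of_nat_mult add.commute)
  have 2: "C = real (n choose k) + real (n choose k')"
    using Suc by (simp add: C_def)
  have nr: "real n = (real s + 1) * real k + real j" unfolding n by (simp add: algebra_simps)
  have "(real j + 1) * real n * C
      = (real n + 1) * (real j * real (n choose k) + (real j + 1 + real s) * real (n choose k'))"
  proof -
    have "(real n + 1) * (real j * real (n choose k) + (real j + 1 + real s) * real (n choose k'))
        = real j * (real n + 1) * C + (1 + real s) * ((real n + 1) * real (n choose k'))"
      unfolding 2 by (simp add: algebra_simps)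
    also have "\<dots> = (real j * (real n + 1) + (1 + real s) * real k) * C"
      unfolding 1[symmetric] by (simp add: algebra_simps)
    also have "real j * (real n + 1) + (1 + real s) * real k = (real j + 1) * real n"
      by (simp add: nr algebra_simps)
    finally show ?thesis by simp
  qed
  then have "(real j + 1) / (real n + 1) * C
      = (real j * real (n choose k) + (real j + 1 + real s) * real (n choose k')) / real n"
    using n0 by (simp add: field_simps)
  moreover have "first_passage_count (Suc j) (Suc n) k = (real j + 1) / (real n + 1) * C"
    by (simp add: first_passage_count_def C_def add_ac)
  moreover have "first_passage_count j n k + first_passage_count (j + 1 + s) n k'
      = (real j * real (n choose k) + (real j + 1 + real s) * real (n choose k')) / real n"
    using n0 unfolding first_passage_count_def by (simp add: add_divide_distrib algebra_simps)
  ultimately show ?thesis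
    using Suc by simp
qed

lemma first_passage_count_weight:
  assumes "k \<le> n" "n > 0"
  shows "first_passage_count j n k * path_weight (n - k) k = real j / (real n * (real n + 1))"
proof -
  have "real (n choose k) * (fact k * fact (n - k)) = fact n"
    using binomial_fact_lemma[OF assms(1)]
    by (metis of_nat_fact of_nat_mult mult.commute)
  then show ?thesis using assms
    by (simp add: first_passage_count_def path_weight_def divide_simps) (simp add: algebra_simps)
qed

section \<open>Analytic estimates\<close>

text \<open>One draw turns a proportion \<open>p\<close> among \<open>T\<close> balls into \<open>p + (1 - p) / (T + 1)\<close> with probability \<open>p\<close> and
  into \<open>p - p / (T + 1)\<close> otherwise. The mean is unchanged and the variance is at most
  \<open>1 / (T + 1)\<^sup>2 \<le> 1 / T - 1 / (T + 1)\<close>, so the squared distance to \<open>c\<close> plus \<open>1 / T\<close> is a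
  supermartingale: the term \<open>1 / T\<close> pays in advance for all the variance to come.\<close>

lemma polya_step_second_moment:
  fixes p T c :: real
  assumes "0 \<le> p" "p \<le> 1" "T > 0"
  shows "p * ((p + (1 - p) / (T + 1) - c)\<^sup>2 + 1 / (T + 1))
       + (1 - p) * ((p - p / (T + 1) - c)\<^sup>2 + 1 / (T + 1)) \<le> (p - c)\<^sup>2 + 1 / T"
proof -
  define u where "u = 1 / (T + 1)"
  have "p * (1 - p) * u\<^sup>2 \<le> 1 * u\<^sup>2"
    using assms by (intro mult_right_mono mult_le_one) auto
  moreover have "u\<^sup>2 \<le> 1 / T - u"
    using assms by (simp add: u_def power2_eq_square divide_simps)
  moreover have "p * ((p + (1 - p) * u - c)\<^sup>2 + u) + (1 - p) * ((p - p * u - c)\<^sup>2 + u)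
      = (p - c)\<^sup>2 + p * (1 - p) * u\<^sup>2 + u"
    by (simp add: power2_eq_square algebra_simps)
  ultimately show ?thesis by (simp add: u_def)
qed

lemma card_nat_interval_le:
  fixes a b :: real
  assumes "a \<le> b" and "\<And>d. d \<in> K \<Longrightarrow> a < real d \<and> real d < b"
  shows "real (card K) \<le> b - a + 1"
proof -
  have "int ` K \<subseteq> {\<lfloor>a\<rfloor> + 1..\<lfloor>b\<rfloor>}"
  proof
    fix i assume "i \<in> int ` K"
    then obtain d where "i = int d" "a < real d" "real d < b" using assms(2) by auto
    then have "\<lfloor>a\<rfloor> < i" "i \<le> \<lfloor>b\<rfloor>" by linarith+
    then show "i \<in> {\<lfloor>a\<rfloor> + 1..\<lfloor>b\<rfloor>}" by simp
  qed
  then have "card (int ` K) \<le> card {\<lfloor>a\<rfloor> + 1..\<lfloor>b\<rfloor>}"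
    by (intro card_mono) auto
  then have "card K \<le> nat (\<lfloor>b\<rfloor> - \<lfloor>a\<rfloor>)"
    by (simp add: card_image)
  then have "real (card K) \<le> real_of_int (\<lfloor>b\<rfloor> - \<lfloor>a\<rfloor>)"
    using floor_mono[OF assms(1)] by linarith
  then show ?thesis by linarith
qed

text \<open>Summation by shifting: \<open>H(x)\<close> has the summands \<open>1 / (k + 1) - 1 / (k + 1 + x)\<close>, and the terms
  \<open>1 / (k + x) - 1 / (k + 1 + x)\<close> telescope to \<open>1 / x\<close>. This is the functional equation of the Digamma
  function.\<close>

lemma sums_gen_harm:
  assumes "x > 0"
  shows "(\<lambda>k. 1 / (real k + x) - 1 / (real k + 1)) sums (1 / x - gen_harm x)"
proof -
  have "(\<lambda>k. inverse (real (Suc k)) - inverse (x + real k)) sums (Digamma x + euler_mascheroni)"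
    using summable_sums[OF summable_Digamma[of x]] assms by (simp add: Digamma_def)
  then have "(\<lambda>k. - (inverse (real (Suc k)) - inverse (x + real k))) sums - (Digamma x + euler_mascheroni)"
    by (rule sums_minus)
  moreover have "- (Digamma x + euler_mascheroni) = 1 / x - gen_harm x"
    using assms by (simp add: gen_harm_eq_Digamma Digamma_plus1)
  ultimately show ?thesis by (simp add: inverse_eq_divide add_ac)
qed

lemma gen_harm_1: "gen_harm 1 = 1"
proof -
  have "(\<lambda>k::nat. 0 :: real) sums (1 - gen_harm 1)"
    using sums_gen_harm[of 1] by simp
  then show ?thesis using sums_unique2[OF _ sums_zero] by fastforce
qed

section \<open>Histories of the urn\<close>

locale standard_urn = polya_urn M 1 1 1 X for M :: "'a measure" and X
begin

abbreviation reds :: "nat \<Rightarrow> 'a \<Rightarrow> nat" where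
  "reds n \<omega> \<equiv> red_draws (\<lambda>i. X i \<omega>) n"

definition share :: "nat \<Rightarrow> 'a \<Rightarrow> real" where
  "share n \<omega> = (real (reds n \<omega>) + 1) / (real n + 2)"

lemma Z_eq: "Z n \<omega> = share n \<omega>"
  unfolding share_def Z_def R_def red_count_def red_draws_def by (simp add: add_ac)

lemma S_eq: "S \<omega> = (SUP n. share n \<omega>)"
  unfolding S_def Z_eq ..

declare measurable_draw [measurable]

lemma measurable_reds [measurable]: "reds n \<in> measurable M (count_space UNIV)"
proof (induction n)
  case 0
  then show ?case by simp
next
  case (Suc n)
  note [measurable] = this
  show ?case unfolding red_draws_Suc by measurable
qed

lemma measurable_share [measurable]: "share n \<in> borel_measurable M"
  unfolding share_def[abs_def] by measurable

lemma share_bounds: "0 \<le> share n \<omega>" "share n \<omega> \<le> 1"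
  using red_draws_le[of "\<lambda>i. X i \<omega>" n] by (auto simp: share_def)

definition history :: "nat \<Rightarrow> (nat \<Rightarrow> bool) \<Rightarrow> 'a set" where
  "history n c = {\<omega> \<in> space M. \<forall>i<n. X i \<omega> = c i}"

lemma history_sets [measurable]: "history n c \<in> sets M"
  unfolding history_def by measurable

lemma history_0 [simp]: "history 0 c = space M"
  by (simp add: history_def)

lemma reds_history: "\<omega> \<in> history n c \<Longrightarrow> reds n \<omega> = red_draws c n"
  unfolding history_def by (intro red_draws_cong) auto

lemma history_split:
  "history n c = history (Suc n) (c(n := True)) \<union> history (Suc n) (c(n := False))"
  "history (Suc n) (c(n := True)) \<inter> history (Suc n) (c(n := False)) = {}"
  by (auto simp: history_def less_Suc_eq)

text \<open>The step of all inductions below. The event \<open>G\<close> typically concerns a later time, so that the same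
  bound or formula can be applied to both longer histories.\<close>

lemma prob_history_split:
  assumes [measurable]: "G \<in> sets M"
  shows "prob (history n c \<inter> G) = prob (history (Suc n) (c(n := True)) \<inter> G)
                                + prob (history (Suc n) (c(n := False)) \<inter> G)"
  unfolding history_split(1)[of n c] Int_Un_distrib2
  by (rule finite_measure_Union) (use history_split(2)[of n c] in auto)

lemma prob_history_red:
  "prob (history (Suc n) (c(n := True))) = (real (red_draws c n) + 1) / (real n + 2) * prob (history n c)"
proof -
  have "history (Suc n) (c(n := True)) = {\<omega> \<in> space M. (\<forall>i<n. X i \<omega> = c i) \<and> X n \<omega>}"
    by (auto simp: history_def less_Suc_eq)
  then show ?thesis using draw_red[of n c]
    by (simp add: red_proportion_def red_count_def red_draws_def history_def add_ac)
qed

lemma prob_history_black: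
  "prob (history (Suc n) (c(n := False))) =
     (1 - (real (red_draws c n) + 1) / (real n + 2)) * prob (history n c)"
  using prob_history_split[of "space M" n c] prob_history_red[of n c]
  by (simp add: algebra_simps sets.sets_into_space Int_absorb2)

lemma prob_history_children:
  "prob (history (Suc n) (c(n := True))) + prob (history (Suc n) (c(n := False))) = prob (history n c)"
  unfolding prob_history_red prob_history_black by (simp add: algebra_simps)

text \<open>Exchangeability: the numerators of the successive conditional probabilities multiply to
  \<open>a! b!\<close> whatever the order of the colours, the denominators to \<open>(n + 1)!\<close>.\<close>

lemma prob_history:
  "red_draws c n = a \<Longrightarrow> n = a + b \<Longrightarrow> prob (history n c) = path_weight a b"
proof (induction n arbitrary: a b)
  case 0
  then show ?case by (simp add: path_weight_def prob_space)
next
  case (Suc n)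
  have upd: "c(n := c n) = c" by simp
  show ?case
  proof (cases "c n")
    case True
    then obtain a' where a: "a = Suc a'" using Suc.prems by (cases a) auto
    have r: "red_draws c n = a'" and n: "n = a' + b" using Suc.prems True a by auto
    have "prob (history (Suc n) c) = (real a' + 1) / (real n + 2) * path_weight a' b"
      using prob_history_red[of n c] Suc.IH[OF r n] r True upd by simp
    also have "\<dots> = path_weight a b"
      unfolding a n by (simp add: path_weight_def field_simps)
    finally show ?thesis .
  next
    case False
    then obtain b' where b: "b = Suc b'" using Suc.prems red_draws_le[of c n] by (cases b) auto
    have r: "red_draws c n = a" and n: "n = a + b'" using Suc.prems False b by auto
    have "prob (history (Suc n) c) = (1 - (real a + 1) / (real n + 2)) * path_weight a b'"
      using prob_history_black[of n c] Suc.IH[OF r n] r False upd by simp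
    also have "1 - (real a + 1) / (real n + 2) = (real b' + 1) / (real n + 2)"
      unfolding n by (simp add: field_simps)
    also have "(real b' + 1) / (real n + 2) * path_weight a b' = path_weight a b"
      unfolding b n by (simp add: path_weight_def field_simps)
    finally show ?thesis .
  qed
qed

text \<open>There are \<open>n choose k\<close> continuations with \<open>k\<close> red draws, all of the same probability; the induction
  is Pascal's rule.\<close>

lemma prob_history_reds:
  assumes "red_draws c m = a" "m = a + b"
  shows "prob (history m c \<inter> {\<omega> \<in> space M. reds (m + n) \<omega> = a + k})
       = real (n choose k) * path_weight (a + k) (b + (n - k))"
  using assms
proof (induction n arbitrary: m c a b k)
  case 0
  have "history m c \<inter> {\<omega> \<in> space M. reds (m + 0) \<omega> = a + k} = (if k = 0 then history m c else {})"
    using 0 reds_history[of _ m c] by (auto simp: history_def)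
  then show ?case using prob_history[OF 0] by (cases k) auto
next
  case (Suc n)
  define G where "G = {\<omega> \<in> space M. reds (Suc m + n) \<omega> = a + k}"
  have [measurable]: "G \<in> sets M" unfolding G_def by measurable
  have goal: "{\<omega> \<in> space M. reds (m + Suc n) \<omega> = a + k} = G" by (simp add: G_def)
  have black: "prob (history (Suc m) (c(m := False)) \<inter> G)
      = real (n choose k) * path_weight (a + k) (Suc b + (n - k))"
    unfolding G_def by (rule Suc.IH, unfold red_draws_upd_Suc) (use Suc.prems in auto)
  show ?case
  proof (cases k)
    case 0
    have "reds (Suc m + n) \<omega> \<ge> Suc a" if "\<omega> \<in> history (Suc m) (c(m := True))" for \<omega>
      using reds_history[OF that] red_draws_mono[of "\<lambda>i. X i \<omega>" "Suc m" n] Suc.prems by simp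
    then have "history (Suc m) (c(m := True)) \<inter> G = {}"
      using 0 unfolding G_def by fastforce
    then show ?thesis using prob_history_split[of G m c] black 0 unfolding goal by simp
  next
    case (Suc k')
    have "prob (history (Suc m) (c(m := True)) \<inter> {\<omega> \<in> space M. reds (Suc m + n) \<omega> = Suc a + k'})
      = real (n choose k') * path_weight (Suc a + k') (b + (n - k'))"
      by (rule Suc.IH, unfold red_draws_upd_Suc) (use Suc.prems in auto)
    moreover have "{\<omega> \<in> space M. reds (Suc m + n) \<omega> = Suc a + k'} = G"
      unfolding G_def Suc by simp
    moreover have "real (n choose k) * path_weight (a + k) (Suc b + (n - k))
       = real (n choose k) * path_weight (a + k) (b + (n - k'))"
      using Suc by (cases "k \<le> n") (auto simp: Suc_diff_Suc)
    ultimately show ?thesis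
      using prob_history_split[of G m c] black Suc unfolding goal by (simp add: algebra_simps)
  qed
qed

text \<open>The number of red draws is uniform on \<open>{0..n}\<close>.\<close>

lemma prob_reds_le: "prob {\<omega> \<in> space M. reds n \<omega> = k} \<le> 1 / (real n + 1)"
proof -
  have "prob (space M \<inter> {\<omega> \<in> space M. reds n \<omega> = k}) = real (n choose k) * path_weight k (n - k)"
    using prob_history_reds[of "\<lambda>_. False" 0 0 0 n k] by simp
  also have "\<dots> \<le> 1 / (real n + 1)"
  proof (cases "k \<le> n")
    case True
    have "real (n choose k) * (fact k * fact (n - k)) = fact n"
      using binomial_fact_lemma[OF True] by (metis of_nat_fact of_nat_mult mult.commute)
    then show ?thesis using True by (simp add: path_weight_def divide_simps)
  next
    case False
    then show ?thesis by (simp add: binomial_eq_0)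
  qed
  finally show ?thesis by (simp add: Int_def conj_commute cong: conj_cong)
qed

section \<open>Hitting probabilities of the slack\<close>

definition first_passage :: "nat \<Rightarrow> int \<Rightarrow> nat \<Rightarrow> nat \<Rightarrow> 'a set" where
  "first_passage s v m n = {\<omega> \<in> space M. slack s (m + n) (reds (m + n) \<omega>) = v
      \<and> (\<forall>i. m \<le> i \<and> i < m + n \<longrightarrow> slack s i (reds i \<omega>) \<noteq> v)}"

lemma first_passage_sets [measurable]: "first_passage s v m n \<in> sets M"
  unfolding first_passage_def by measurable

lemma first_passage_Suc:
  "\<omega> \<in> first_passage s v m (Suc n) \<longleftrightarrow>
     slack s m (reds m \<omega>) \<noteq> v \<and> \<omega> \<in> first_passage s v (Suc m) n"
proof -
  have "(\<forall>i. m \<le> i \<and> i < m + Suc n \<longrightarrow> slack s i (reds i \<omega>) \<noteq> v) \<longleftrightarrow>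
    slack s m (reds m \<omega>) \<noteq> v \<and> (\<forall>i. Suc m \<le> i \<and> i < Suc m + n \<longrightarrow> slack s i (reds i \<omega>) \<noteq> v)"
    by (metis Suc_leD add_Suc_right add_Suc le_eq_less_or_eq Suc_leI less_add_Suc1)
  then show ?thesis by (auto simp: first_passage_def)
qed

text \<open>Number of paths times common probability. The induction follows the recursion of
  \<open>first_passage_count\<close>; if no black draw is left (\<open>k = 0\<close>), a black draw puts the level out of reach,
  as the slack cannot fall by more than the number of remaining draws.\<close>

lemma prob_history_first_passage:
  assumes "red_draws c m = a" "m = a + b"
    and "slack s m a = v + int j" and "n = (s + 1) * k + j"
  shows "prob (history m c \<inter> first_passage s v m n)
       = first_passage_count j n k * path_weight (a + (n - k)) (b + k)"
  using assms
proof (induction n arbitrary: m c a b j k)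
  case 0
  then have "history m c \<inter> first_passage s v m 0 = history m c"
    using reds_history[of _ m c] by (auto simp: first_passage_def history_def)
  then show ?case using prob_history[OF 0(1,2)] 0 by (simp add: first_passage_count_def)
next
  case (Suc n)
  show ?case
  proof (cases j)
    case 0
    then have "slack s m (reds m \<omega>) = v" if "\<omega> \<in> history m c" for \<omega>
      using reds_history[OF that] Suc.prems by simp
    then have "history m c \<inter> first_passage s v m (Suc n) = {}"
      by (auto simp: first_passage_Suc)
    then show ?thesis using 0 by (simp add: first_passage_count_def)
  next
    case (Suc i)
    let ?G = "first_passage s v (Suc m) n"
    have n: "n = (s + 1) * k + i" using Suc.prems Suc by simp
    have "history m c \<inter> first_passage s v m (Suc n) = history m c \<inter> ?G"
      using reds_history[of _ m c] Suc.prems Suc by (auto simp: first_passage_Suc)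
    then have split: "prob (history m c \<inter> first_passage s v m (Suc n)) =
        prob (history (Suc m) (c(m := True)) \<inter> ?G) + prob (history (Suc m) (c(m := False)) \<inter> ?G)"
      using prob_history_split[of ?G m c] by simp
    have red: "prob (history (Suc m) (c(m := True)) \<inter> ?G)
       = first_passage_count i n k * path_weight (Suc a + (n - k)) (b + k)"
      by (rule Suc.IH, unfold red_draws_upd_Suc) (use Suc.prems Suc n in \<open>auto simp: slack_red\<close>)
    have black: "prob (history (Suc m) (c(m := False)) \<inter> ?G)
       = (if k = 0 then 0 else first_passage_count (i + 1 + s) n (k - 1) * path_weight (a + (Suc n - k)) (b + k))"
    proof (cases k)
      case 0
      have "\<omega> \<notin> ?G" if "\<omega> \<in> history (Suc m) (c(m := False))" for \<omega>
      proof -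
        have "slack s (Suc m) (reds (Suc m) \<omega>) = v + int (j + s)"
          using reds_history[OF that] Suc.prems by (simp add: slack_black)
        then have "slack s (Suc m + n) (reds (Suc m + n) \<omega>) > v"
          using slack_decrease_le[of s "Suc m" "\<lambda>i. X i \<omega>" n] n 0 Suc
          by simp
        then show ?thesis by (auto simp: first_passage_def)
      qed
      then have "history (Suc m) (c(m := False)) \<inter> ?G = {}" by blast
      then show ?thesis using 0 by simp
    next
      case (Suc k')
      have "prob (history (Suc m) (c(m := False)) \<inter> ?G)
         = first_passage_count (i + 1 + s) n k' * path_weight (a + (n - k')) (Suc b + k')"
        by (rule Suc.IH, unfold red_draws_upd_Suc) (use Suc.prems \<open>j = Suc i\<close> n Suc in \<open>auto simp: slack_black\<close>)
      then show ?thesis using Suc by simp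
    qed
    have "Suc a + (n - k) = a + (Suc n - k)"
      using n by (simp add: Suc_diff_le)
    then have "path_weight (Suc a + (n - k)) (b + k) = path_weight (a + (Suc n - k)) (b + k)"
      by (rule arg_cong)
    then show ?thesis
      unfolding split red black Suc first_passage_count_rec[OF n] by (simp add: distrib_right)
  qed
qed

text \<open>The slack at a given time determines the number of draws from the number of black draws. This lets
  the possible hitting times be indexed by \<open>k\<close>.\<close>

lemma first_passage_time:
  assumes "slack s n (reds n \<omega>) = int s - 1 - int j"
  shows "n = (s + 1) * (n - reds n \<omega>) + j"
proof -
  define k where "k = n - reds n \<omega>"
  have count: "int (reds n \<omega>) = int n - int k"
    using red_draws_le[of "\<lambda>i. X i \<omega>" n] by (simp add: k_def)
  have "int n = (int s + 1) * int k + int j"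
    using assms unfolding slack_def count by (simp add: algebra_simps)
  also have "\<dots> = int ((s + 1) * k + j)" by (simp add: algebra_simps)
  finally show ?thesis unfolding k_def by linarith
qed

lemma prob_hit_sums:
  assumes "j > 0"
  shows "(\<lambda>k. real j / (real ((s + 1) * k + j) * (real ((s + 1) * k + j) + 1))) sums
           prob {\<omega> \<in> space M. \<exists>n. slack s n (reds n \<omega>) = int s - 1 - int j}"
proof -
  let ?v = "int s - 1 - int j"
  define n where "n k = (s + 1) * k + j" for k
  define F where "F k = first_passage s ?v 0 (n k)" for k
  have "prob (F k) = real j / (real (n k) * (real (n k) + 1))" for k
  proof -
    have "prob (F k) = prob (history 0 (\<lambda>_. False) \<inter> F k)"
      by (simp add: F_def Int_absorb1 sets.sets_into_space)
    also have "\<dots> = first_passage_count j (n k) k * path_weight (0 + (n k - k)) (0 + k)"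
      unfolding F_def by (rule prob_history_first_passage) (auto simp: slack_def n_def)
    also have "\<dots> = real j / (real (n k) * (real (n k) + 1))"
      using first_passage_count_weight[of k "n k" j] assms by (simp add: n_def)
    finally show ?thesis .
  qed
  moreover have "disjoint_family F"
  proof -
    have "F k \<inter> F l = {}" if "k < l" for k l
    proof -
      have "n k < n l" using that by (simp add: n_def mult_less_mono2 del: mult_Suc)
      then show ?thesis by (auto simp: F_def first_passage_def)
    qed
    then show ?thesis
      unfolding disjoint_family_on_def by (metis Int_commute linorder_neqE_nat)
  qed
  moreover have "(\<Union>k. F k) = {\<omega> \<in> space M. \<exists>n. slack s n (reds n \<omega>) = ?v}"
  proof (intro equalityI subsetI)
    fix \<omega> assume "\<omega> \<in> {\<omega> \<in> space M. \<exists>n. slack s n (reds n \<omega>) = ?v}"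
    then obtain m where \<omega>: "\<omega> \<in> space M" and m: "slack s m (reds m \<omega>) = ?v"
      and min: "\<And>i. i < m \<Longrightarrow> slack s i (reds i \<omega>) \<noteq> ?v"
      using exists_least_iff[of "\<lambda>n. slack s n (reds n \<omega>) = ?v"] by auto
    have "m = n (m - reds m \<omega>)"
      using first_passage_time[OF m] by (simp add: n_def)
    then have "\<omega> \<in> F (m - reds m \<omega>)"
      using \<omega> m min by (simp add: F_def first_passage_def)
    then show "\<omega> \<in> (\<Union>k. F k)" by blast
  qed (auto simp: F_def first_passage_def)
  moreover have "(\<lambda>k. prob (F k)) sums prob (\<Union>k. F k)"
    by (rule finite_measure_UNION[OF _ \<open>disjoint_family F\<close>]) (auto simp: F_def)
  ultimately show ?thesis by (simp add: n_def)
qed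

text \<open>With \<open>y = j / t\<close> and \<open>x = (j + 1) / t\<close>, the summand \<open>j / (n * (n + 1))\<close> at \<open>n = t * k + j\<close> equals
  \<open>y * (1 / (k + y) - 1 / (k + x))\<close>.\<close>

lemma prob_hit:
  assumes j: "j > 0" and t: "t = s + 1"
  shows "prob {\<omega> \<in> space M. \<exists>n. slack s n (reds n \<omega>) = int s - 1 - int j}
       = 1 - real j / real t * gen_harm (real j / real t)
           - real j / (real j + 1) + real j / real t * gen_harm ((real j + 1) / real t)"
proof -
  define y where "y = real j / real t"
  define x where "x = (real j + 1) / real t"
  have pos: "y > 0" "x > 0" "real t > 0" using j t by (auto simp: x_def y_def)
  have series: "(\<lambda>k. y * ((1 / (real k + y) - 1 / (real k + 1)) - (1 / (real k + x) - 1 / (real k + 1))))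
          sums (y * ((1 / y - gen_harm y) - (1 / x - gen_harm x)))"
    using pos by (intro sums_mult sums_diff sums_gen_harm)
  have summand: "y * ((1 / (real k + y) - 1 / (real k + 1)) - (1 / (real k + x) - 1 / (real k + 1)))
      = real j / (real ((s + 1) * k + j) * (real ((s + 1) * k + j) + 1))" for k
  proof -
    define u where "u = real t * real k + real j"
    have u: "u > 0" using j by (simp add: u_def add_nonneg_pos)
    have "real k + y = u / real t" "real k + x = (u + 1) / real t"
      using pos by (auto simp: u_def x_def y_def add_divide_distrib)
    then have "y * ((1 / (real k + y) - 1 / (real k + 1)) - (1 / (real k + x) - 1 / (real k + 1)))
        = y * (real t / u - real t / (u + 1))" by simp
    also have "\<dots> = real j / (u * (u + 1))"
      using pos(3) u by (simp add: y_def field_simps)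
    also have "u = real ((s + 1) * k + j)"
      by (simp add: u_def t algebra_simps)
    finally show ?thesis .
  qed
  have "prob {\<omega> \<in> space M. \<exists>n. slack s n (reds n \<omega>) = int s - 1 - int j}
      = y * ((1 / y - gen_harm y) - (1 / x - gen_harm x))"
    by (rule sums_unique2[OF prob_hit_sums[OF j] series[unfolded summand]])
  also have "\<dots> = 1 - y * gen_harm y - y / x + y * gen_harm x"
    using pos by (simp add: algebra_simps)
  also have "y / x = real j / (real j + 1)"
    using pos(3) by (simp add: x_def y_def)
  finally show ?thesis by (simp add: x_def y_def)
qed

section \<open>A supremum is almost surely attained\<close>

text \<open>Chebyshev's inequality for a future share, with the second moment about an arbitrary \<open>c\<close>. The centre
  has to be free since the proportion changes along the induction; in the application it is the
  present proportion, which makes the square vanish.\<close>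

lemma prob_history_share_le:
  assumes "y < c"
  shows "prob (history n h \<inter> {\<omega> \<in> space M. share (n + k) \<omega> \<le> y})
    \<le> prob (history n h) *
       ((((real (red_draws h n) + 1) / (real n + 2) - c)\<^sup>2 + 1 / (real n + 2)) / (c - y)\<^sup>2)"
proof (induction k arbitrary: n h)
  case 0
  let ?p = "(real (red_draws h n) + 1) / (real n + 2)"
  have Z: "share n \<omega> = ?p" if "\<omega> \<in> history n h" for \<omega>
    using reds_history[OF that] by (simp add: share_def)
  show ?case
  proof (cases "?p \<le> y")
    case True
    have "(c - y)\<^sup>2 \<le> (c - ?p)\<^sup>2" using True assms by (intro power_mono) auto
    then have "1 \<le> ((?p - c)\<^sup>2 + 1 / (real n + 2)) / (c - y)\<^sup>2"
      using assms by (simp add: power2_commute le_divide_eq_1 add_increasing2)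
    then have "prob (history n h) \<le> prob (history n h) * (((?p - c)\<^sup>2 + 1 / (real n + 2)) / (c - y)\<^sup>2)"
      using mult_left_mono[of 1 _ "prob (history n h)"] by (simp only: mult_1_right measure_nonneg)
    moreover have "prob (history n h \<inter> {\<omega> \<in> space M. share (n + 0) \<omega> \<le> y}) \<le> prob (history n h)"
      by (intro finite_measure_mono) auto
    ultimately show ?thesis by linarith
  next
    case False
    then have "history n h \<inter> {\<omega> \<in> space M. share (n + 0) \<omega> \<le> y} = {}"
      using Z by auto
    then show ?thesis by simp
  qed
next
  case (Suc k)
  define T where "T = real n + 2"
  define p where "p = (real (red_draws h n) + 1) / T"
  have T: "T > 0" by (simp add: T_def)
  have p: "0 \<le> p" "p \<le> 1"
    using red_draws_le[of h n] by (auto simp: p_def T_def divide_simps)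
  have T1: "real (Suc n) + 2 = T + 1" by (simp add: T_def)
  have child: "(real (red_draws h n + (if True then 1 else 0)) + 1) / (T + 1) = p + (1 - p) / (T + 1)"
    "(real (red_draws h n + (if False then 1 else 0)) + 1) / (T + 1) = p - p / (T + 1)"
    using T by (auto simp: p_def divide_simps) (auto simp: algebra_simps)
  let ?G = "{\<omega> \<in> space M. share (Suc n + k) \<omega> \<le> y}"
  have G: "?G \<in> sets M" by measurable
  have "prob (history (Suc n) (h(n := True)) \<inter> ?G)
     \<le> p * prob (history n h) * (((p + (1 - p) / (T + 1) - c)\<^sup>2 + 1 / (T + 1)) / (c - y)\<^sup>2)"
    by (rule Suc.IH[of "Suc n" "h(n := True)",
          unfolded red_draws_upd_Suc prob_history_red T_def[symmetric] T1 p_def[symmetric] child])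
  moreover have "prob (history (Suc n) (h(n := False)) \<inter> ?G)
     \<le> (1 - p) * prob (history n h) * (((p - p / (T + 1) - c)\<^sup>2 + 1 / (T + 1)) / (c - y)\<^sup>2)"
    by (rule Suc.IH[of "Suc n" "h(n := False)",
          unfolded red_draws_upd_Suc prob_history_black T_def[symmetric] T1 p_def[symmetric] child])
  ultimately have "prob (history n h \<inter> ?G)
     \<le> p * prob (history n h) * (((p + (1 - p) / (T + 1) - c)\<^sup>2 + 1 / (T + 1)) / (c - y)\<^sup>2)
       + (1 - p) * prob (history n h) * (((p - p / (T + 1) - c)\<^sup>2 + 1 / (T + 1)) / (c - y)\<^sup>2)"
    using prob_history_split[OF G, of n h] by simp
  also have "\<dots> = prob (history n h) * ((p * ((p + (1 - p) / (T + 1) - c)\<^sup>2 + 1 / (T + 1))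
       + (1 - p) * ((p - p / (T + 1) - c)\<^sup>2 + 1 / (T + 1))) / (c - y)\<^sup>2)"
    by (simp add: add_divide_distrib distrib_left mult_ac)
  also have "\<dots> \<le> prob (history n h) * (((p - c)\<^sup>2 + 1 / T) / (c - y)\<^sup>2)"
    by (intro mult_left_mono divide_right_mono polya_step_second_moment p T) auto
  finally show ?case by (simp add: p_def T_def)
qed

text \<open>A maximal inequality: as long as the level \<open>z\<close> has not been reached at a time \<open>\<ge> N\<close>, condition on
  the next draw; as soon as it has, apply the Chebyshev bound from there. The bound is proportional to the
  probability of the history, and hence passes through the conditioning unchanged.\<close>

lemma prob_history_downcrossing:
  assumes "y < z"
  shows "prob (history n h \<inter> {\<omega> \<in> space M.
            (\<exists>i. N \<le> i \<and> n \<le> i \<and> i \<le> n + k \<and> z \<le> share i \<omega>) \<and> share (n + k) \<omega> \<le> y})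
    \<le> prob (history n h) / ((real N + 2) * (z - y)\<^sup>2)"
proof (induction k arbitrary: n h)
  case 0
  let ?A = "history n h \<inter> {\<omega> \<in> space M. (\<exists>i. N \<le> i \<and> n \<le> i \<and> i \<le> n + 0 \<and> z \<le> share i \<omega>) \<and> share (n + 0) \<omega> \<le> y}"
  have "?A = {}" using assms by fastforce
  then show ?case using assms by simp
next
  case (Suc k)
  let ?p = "(real (red_draws h n) + 1) / (real n + 2)"
  define E where "E n k = {\<omega> \<in> space M. (\<exists>i. N \<le> i \<and> n \<le> i \<and> i \<le> n + k \<and> z \<le> share i \<omega>) \<and> share (n + k) \<omega> \<le> y}" for n k
  have E: "E n k \<in> sets M" for n k unfolding E_def by measurable
  have hist: "share n \<omega> = ?p" if "\<omega> \<in> history n h" for \<omega>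
    using reds_history[OF that] by (simp add: share_def)
  have "prob (history n h \<inter> E n (Suc k)) \<le> prob (history n h) / ((real N + 2) * (z - y)\<^sup>2)"
  proof (cases "N \<le> n \<and> z \<le> ?p")
    case True
    have "prob (history n h \<inter> E n (Suc k)) \<le> prob (history n h \<inter> {\<omega> \<in> space M. share (n + Suc k) \<omega> \<le> y})"
      by (intro finite_measure_mono) (auto simp: E_def)
    also have "\<dots> \<le> prob (history n h) * (((?p - ?p)\<^sup>2 + 1 / (real n + 2)) / (?p - y)\<^sup>2)"
      using True assms by (intro prob_history_share_le) auto
    also have "\<dots> = prob (history n h) / ((real n + 2) * (?p - y)\<^sup>2)"
      by (simp del: divide_const_simps)
    also have "\<dots> \<le> prob (history n h) / ((real N + 2) * (z - y)\<^sup>2)"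
      using True assms by (intro divide_left_mono mult_mono power_mono mult_pos_pos measure_nonneg) auto
    finally show ?thesis .
  next
    case False
    have "history n h \<inter> E n (Suc k) \<subseteq> E (Suc n) k"
    proof
      fix \<omega> assume \<omega>: "\<omega> \<in> history n h \<inter> E n (Suc k)"
      then obtain i where i: "N \<le> i" "n \<le> i" "i \<le> n + Suc k" "z \<le> share i \<omega>" by (auto simp: E_def)
      have "i \<noteq> n" using i False hist[of \<omega>] \<omega> by auto
      then have "Suc n \<le> i" "i \<le> Suc n + k" using i by auto
      then show "\<omega> \<in> E (Suc n) k" using i \<omega> unfolding E_def by auto
    qed
    then have "prob (history n h \<inter> E n (Suc k)) \<le> prob (history n h \<inter> E (Suc n) k)"
      by (intro finite_measure_mono) (auto intro: E)
    also have "\<dots> = prob (history (Suc n) (h(n := True)) \<inter> E (Suc n) k)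
                 + prob (history (Suc n) (h(n := False)) \<inter> E (Suc n) k)"
      by (rule prob_history_split[OF E])
    also have "\<dots> \<le> prob (history (Suc n) (h(n := True))) / ((real N + 2) * (z - y)\<^sup>2)
                 + prob (history (Suc n) (h(n := False))) / ((real N + 2) * (z - y)\<^sup>2)"
      unfolding E_def by (intro add_mono Suc.IH)
    also have "\<dots> = prob (history n h) / ((real N + 2) * (z - y)\<^sup>2)"
      unfolding add_divide_distrib[symmetric] prob_history_children ..
    finally show ?thesis .
  qed
  then show ?case by (simp only: E_def)
qed

text \<open>An interval of length \<open>x - y\<close> contains at most \<open>(x - y) * (m + 2) + 1\<close> of the possible values,
  which are multiples of \<open>1 / (m + 2)\<close>.\<close>

lemma prob_share_between_le:
  assumes "y \<le> x"
  shows "prob {\<omega> \<in> space M. y < share m \<omega> \<and> share m \<omega> < x} \<le> (x - y) + (x - y + 1) / (real m + 1)"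
proof -
  define K where "K = {d. d \<le> m \<and> y * (real m + 2) - 1 < real d \<and> real d < x * (real m + 2) - 1}"
  have "finite K" unfolding K_def by (rule finite_subset[of _ "{..m}"]) auto
  have "{\<omega> \<in> space M. y < share m \<omega> \<and> share m \<omega> < x} = (\<Union>d\<in>K. {\<omega> \<in> space M. reds m \<omega> = d})"
    using red_draws_le by (auto simp: K_def share_def pos_less_divide_eq pos_divide_less_eq)
  then have "prob {\<omega> \<in> space M. y < share m \<omega> \<and> share m \<omega> < x} = prob (\<Union>d\<in>K. {\<omega> \<in> space M. reds m \<omega> = d})"
    by simp
  also have "\<dots> \<le> (\<Sum>d\<in>K. prob {\<omega> \<in> space M. reds m \<omega> = d})"
    by (intro finite_measure_subadditive_finite \<open>finite K\<close>) (auto, measurable)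
  also have "\<dots> \<le> (\<Sum>d\<in>K. 1 / (real m + 1))"
    by (intro sum_mono prob_reds_le)
  also have "\<dots> = real (card K) / (real m + 1)" by simp
  also have "\<dots> \<le> ((x * (real m + 2) - 1) - (y * (real m + 2) - 1) + 1) / (real m + 1)"
    using assms by (intro divide_right_mono card_nat_interval_le diff_right_mono mult_right_mono) (auto simp: K_def)
  also have "\<dots> = (x - y) + (x - y + 1) / (real m + 1)"
    by (simp add: field_simps)
  finally show ?thesis .
qed

lemma bdd_above_share: "bdd_above (range (\<lambda>n. share n \<omega>))"
  using share_bounds by (intro bdd_aboveI[of _ 1]) auto

lemma measurable_SUP_share [measurable]: "(\<lambda>\<omega>. SUP n. share n \<omega>) \<in> borel_measurable M"
  by (intro borel_measurable_cSUP) (auto intro: bdd_above_share)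

lemma unattained_SUP_near:
  assumes "\<And>n. share n \<omega> < x" and "(SUP n. share n \<omega>) = x" and "z < x"
  shows "\<exists>n\<ge>N. z \<le> share n \<omega>"
proof (rule ccontr)
  assume not: "\<not> (\<exists>n\<ge>N. z \<le> share n \<omega>)"
  define B where "B = Max (insert z ((\<lambda>n. share n \<omega>) ` {..<N}))"
  have "share n \<omega> \<le> B" for n
  proof (cases "n < N")
    case True
    then show ?thesis unfolding B_def by (intro Max_ge) auto
  next
    case False
    then have "share n \<omega> \<le> z" using not by (meson linorder_le_less_linear less_le_not_le nle_le)
    also have "z \<le> B" unfolding B_def by (intro Max_ge) auto
    finally show ?thesis .
  qed
  then have "(SUP n. share n \<omega>) \<le> B" by (intro cSUP_least) auto
  moreover have "B < x" unfolding B_def using assms(1,3) by (subst Max_less_iff) auto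
  ultimately show False using assms(2) by simp
qed

text \<open>For fixed \<open>e\<close> and \<open>N\<close>, on this event the share reaches \<open>x - e\<close> at a time between \<open>N\<close> and \<open>m\<close>, if \<open>m\<close> is
  large. Then either it has dropped to \<open>x - 2 * e\<close> at time \<open>m\<close>, or it lies between \<open>x - 2 * e\<close> and \<open>x\<close>.
  The limits are taken in the order \<open>m\<close>, \<open>N\<close>, \<open>e\<close>.\<close>

lemma prob_SUP_unattained: "prob {\<omega> \<in> space M. (\<forall>n. share n \<omega> < x) \<and> (SUP n. share n \<omega>) = x} = 0"
proof -
  let ?E = "{\<omega> \<in> space M. (\<forall>n. share n \<omega> < x) \<and> (SUP n. share n \<omega>) = x}"
  have E: "?E \<in> sets M" by measurable
  have bound: "prob ?E \<le> 1 / ((real N + 2) * e\<^sup>2) + 2 * e" if e: "e > 0" for N e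
  proof -
    define A where "A m = {\<omega> \<in> ?E. \<exists>i. N \<le> i \<and> i \<le> m \<and> x - e \<le> share i \<omega>}" for m
    have A: "A m \<in> sets M" for m unfolding A_def using E by measurable
    have "(\<Union>m. A m) = ?E"
    proof (intro equalityI subsetI)
      fix \<omega> assume \<omega>: "\<omega> \<in> ?E"
      then obtain n where "N \<le> n" "x - e \<le> share n \<omega>"
        using unattained_SUP_near[of \<omega> x "x - e" N] e by auto
      then have "\<omega> \<in> A n" using \<omega> unfolding A_def by blast
      then show "\<omega> \<in> (\<Union>m. A m)" by blast
    qed (auto simp: A_def)
    moreover have "incseq A" unfolding incseq_def A_def by (auto intro: order_trans)
    ultimately have lim: "(\<lambda>m. prob (A m)) \<longlonglongrightarrow> prob ?E"
      using finite_Lim_measure_incseq[of A] A by (auto simp: image_subset_iff)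
    have each: "prob (A m) \<le> 1 / ((real N + 2) * e\<^sup>2) + (2 * e + (2 * e + 1) / (real m + 1))" for m
    proof -
      let ?B = "{\<omega> \<in> space M. (\<exists>i. N \<le> i \<and> 0 \<le> i \<and> i \<le> 0 + m \<and> x - e \<le> share i \<omega>) \<and> share (0 + m) \<omega> \<le> x - 2 * e}"
      let ?C = "{\<omega> \<in> space M. x - 2 * e < share m \<omega> \<and> share m \<omega> < x}"
      have B: "?B \<in> sets M" and C: "?C \<in> sets M" by measurable
      have "prob (A m) \<le> prob (?B \<union> ?C)"
        by (intro finite_measure_mono sets.Un B C) (auto simp: A_def)
      also have "\<dots> \<le> prob ?B + prob ?C"
        by (intro measure_Un_le B C)
      also have "prob ?B \<le> 1 / ((real N + 2) * e\<^sup>2)"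
      proof -
        have "prob (history 0 (\<lambda>_. False) \<inter> ?B) \<le> prob (history 0 (\<lambda>_. False)) / ((real N + 2) * (x - e - (x - 2 * e))\<^sup>2)"
          using e by (intro prob_history_downcrossing) auto
        moreover have "space M \<inter> ?B = ?B" by auto
        moreover have "x - e - (x - 2 * e) = e" by simp
        ultimately show ?thesis by (simp only: history_0 prob_space)
      qed
      also have "prob ?C \<le> 2 * e + (2 * e + 1) / (real m + 1)"
        using prob_share_between_le[of "x - 2 * e" x m] e by simp
      finally show ?thesis by simp
    qed
    have "(\<lambda>m. 1 / ((real N + 2) * e\<^sup>2) + (2 * e + (2 * e + 1) / (real m + 1)))
        \<longlonglongrightarrow> 1 / ((real N + 2) * e\<^sup>2) + (2 * e + 0)"
      using tendsto_mult_right_zero[OF LIMSEQ_inverse_real_of_nat, of "2 * e + 1"]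
      by (intro tendsto_intros) (simp add: field_simps)
    from LIMSEQ_le[OF lim this] each show ?thesis by simp
  qed
  have small: "prob ?E \<le> 2 * e" if e: "e > 0" for e
  proof -
    have "(\<lambda>N. 1 / ((real N + 2) * e\<^sup>2) + 2 * e) \<longlonglongrightarrow> 0 + 2 * e"
    proof (intro tendsto_intros)
      have "filterlim (\<lambda>N. (real N + 2) * e\<^sup>2) at_top sequentially"
        using filterlim_tendsto_add_at_top[OF tendsto_const[of 2] filterlim_real_sequentially] e
        by (intro filterlim_at_top_mult_tendsto_pos[OF tendsto_const]) (auto simp: add.commute)
      then show "(\<lambda>N. 1 / ((real N + 2) * e\<^sup>2)) \<longlonglongrightarrow> 0"
        by (rule real_tendsto_divide_at_top[OF tendsto_const])
    qed
    then have "prob ?E \<le> 0 + 2 * e"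
      by (rule LIMSEQ_le_const) (use bound[OF e] in blast)
    then show ?thesis by simp
  qed
  have "prob ?E \<le> 0 + e" if "e > 0" for e
    using small[of "e / 2"] that by simp
  then have "prob ?E \<le> 0" by (rule field_le_epsilon)
  then show ?thesis using measure_nonneg[of M ?E] by linarith
qed

section \<open>The law of the supremum\<close>

lemma slack_sign_iff_share:
  assumes "t \<ge> 2"
  shows "slack (t - 1) n (reds n \<omega>) < 0 \<longleftrightarrow> (real t - 1) / real t < share n \<omega>"
    and "slack (t - 1) n (reds n \<omega>) \<le> 0 \<longleftrightarrow> (real t - 1) / real t \<le> share n \<omega>"
proof -
  have s: "real_of_int (slack (t - 1) n (reds n \<omega>)) = (real t - 1) * (real n + 2) - real t * (real (reds n \<omega>) + 1)"
    using assms by (simp add: slack_def of_nat_diff algebra_simps)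
  have "slack (t - 1) n (reds n \<omega>) < 0 \<longleftrightarrow> real_of_int (slack (t - 1) n (reds n \<omega>)) < 0"
    and "slack (t - 1) n (reds n \<omega>) \<le> 0 \<longleftrightarrow> real_of_int (slack (t - 1) n (reds n \<omega>)) \<le> 0" by simp_all
  then show "slack (t - 1) n (reds n \<omega>) < 0 \<longleftrightarrow> (real t - 1) / real t < share n \<omega>"
    and "slack (t - 1) n (reds n \<omega>) \<le> 0 \<longleftrightarrow> (real t - 1) / real t \<le> share n \<omega>"
    unfolding s share_def using assms by (simp_all add: field_simps)
qed

lemma prob_SUP_le:
  assumes t: "t \<ge> 2"
  shows "prob {\<omega> \<in> space M. (SUP n. share n \<omega>) \<le> (real t - 1) / real t}
       = (1 - 1 / real t) * gen_harm (1 - 1 / real t)"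
proof -
  \<comment> \<open>The supremum exceeds the bound iff the slack hits \<open>-1\<close>, a drop by \<open>s\<close>.\<close>
  define s where "s = t - 1"
  let ?H = "{\<omega> \<in> space M. \<exists>n. slack s n (reds n \<omega>) = int s - 1 - int s}"
  have s: "s > 0" "t = s + 1" "1 - 1 / real t = real s / real t" "(real s + 1) / real t = 1"
    using t by (auto simp: s_def field_simps)
  have "(\<exists>n. slack s n (reds n \<omega>) = int s - 1 - int s) \<longleftrightarrow> \<not> (SUP n. share n \<omega>) \<le> (real t - 1) / real t" for \<omega>
  proof -
    have "(\<exists>n. slack s n (reds n \<omega>) = int s - 1 - int s) \<longleftrightarrow> (\<exists>n. slack s n (reds n \<omega>) \<le> int s - 1 - int s)"
      by (rule slack_hits_iff) simp
    also have "\<dots> \<longleftrightarrow> (\<exists>n. slack s n (reds n \<omega>) < 0)"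
      by (intro ex_cong1) linarith
    also have "\<dots> \<longleftrightarrow> \<not> (\<forall>n. share n \<omega> \<le> (real t - 1) / real t)"
      using slack_sign_iff_share(1)[OF t] by (auto simp: s_def not_le)
    also have "\<dots> \<longleftrightarrow> \<not> (SUP n. share n \<omega>) \<le> (real t - 1) / real t"
      using cSUP_le_iff[OF _ bdd_above_share] by auto
    finally show ?thesis .
  qed
  then have "{\<omega> \<in> space M. (SUP n. share n \<omega>) \<le> (real t - 1) / real t} = space M - ?H"
    by auto
  moreover have "?H \<in> sets M" by measurable
  moreover have "real s / real t = real s / (real s + 1)"
    by (simp add: s(2) add_ac)
  ultimately show ?thesis
    unfolding s(3) by (simp only: prob_compl prob_hit[OF s(1,2)] s(4) gen_harm_1)
qed

lemma prob_always_less: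
  assumes t: "t \<ge> 2"
  shows "prob {\<omega> \<in> space M. \<forall>n. share n \<omega> < (real t - 1) / real t}
       = (real t - 2) / real t * gen_harm (1 - 2 / real t) + (real t - 2) / (real t - 1)
         - (real t - 2) / real t * gen_harm (1 - 1 / real t)"
proof (cases "t = 2")
  case True
  \<comment> \<open>The urn starts with proportion \<open>1 / 2\<close>; the drop to level \<open>0\<close> is \<open>j = 0\<close> here.\<close>
  then have "{\<omega> \<in> space M. \<forall>n. share n \<omega> < (real t - 1) / real t} = {}"
    by (auto simp: share_def intro!: exI[of _ 0])
  then show ?thesis unfolding True by (simp only: measure_empty) simp
next
  case False
  define s where "s = t - 1"
  define j where "j = t - 2"
  let ?H = "{\<omega> \<in> space M. \<exists>n. slack s n (reds n \<omega>) = int s - 1 - int j}"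
  have s: "j > 0" "t = s + 1" and v: "int s - 1 - int j = 0"
    using t False by (auto simp: s_def j_def)
  have real_j: "real j = real t - 2" "real t - 2 + 1 = real t - 1"
    using t by (auto simp: j_def of_nat_diff)
  have ratio: "1 - 2 / real t = (real t - 2) / real t" "1 - 1 / real t = (real t - 1) / real t"
    using t by (auto simp: field_simps)
  have "(\<exists>n. slack s n (reds n \<omega>) = 0) \<longleftrightarrow> \<not> (\<forall>n. share n \<omega> < (real t - 1) / real t)" for \<omega>
  proof -
    have "(\<exists>n. slack s n (reds n \<omega>) = 0) \<longleftrightarrow> (\<exists>n. slack s n (reds n \<omega>) \<le> 0)"
      by (rule slack_hits_iff) (use s v in simp)
    also have "\<dots> \<longleftrightarrow> \<not> (\<forall>n. share n \<omega> < (real t - 1) / real t)"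
      using slack_sign_iff_share(2)[OF t] by (auto simp: s_def not_less)
    finally show ?thesis .
  qed
  then have "{\<omega> \<in> space M. \<forall>n. share n \<omega> < (real t - 1) / real t} = space M - ?H"
    unfolding v by auto
  moreover have "?H \<in> sets M" by measurable
  ultimately show ?thesis
    unfolding ratio by (simp only: prob_compl prob_hit[OF s] real_j)
qed

text \<open>A supremum of at most \<open>x\<close> means that all shares are below \<open>x\<close>, or that the supremum is \<open>x\<close> and
  attained. Leaving out "attained" changes the event by a null set only.\<close>

lemma prob_SUP_eq:
  "prob {\<omega> \<in> space M. (SUP n. share n \<omega>) = x} =
     prob {\<omega> \<in> space M. (SUP n. share n \<omega>) \<le> x} - prob {\<omega> \<in> space M. \<forall>n. share n \<omega> < x}"
proof -
  let ?L = "{\<omega> \<in> space M. \<forall>n. share n \<omega> < x}"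
  let ?A = "{\<omega> \<in> space M. \<not> (\<forall>n. share n \<omega> < x) \<and> (SUP n. share n \<omega>) = x}"
  let ?U = "{\<omega> \<in> space M. (\<forall>n. share n \<omega> < x) \<and> (SUP n. share n \<omega>) = x}"
  have L: "?L \<in> sets M" and A: "?A \<in> sets M" and U: "?U \<in> sets M" by measurable
  have le: "(SUP n. share n \<omega>) \<le> x \<longleftrightarrow> (\<forall>n. share n \<omega> \<le> x)" for \<omega>
    using cSUP_le_iff[OF _ bdd_above_share] by auto
  have "(SUP n. share n \<omega>) \<le> x \<longleftrightarrow> (\<forall>n. share n \<omega> < x) \<or> \<not> (\<forall>n. share n \<omega> < x) \<and> (SUP n. share n \<omega>) = x" for \<omega>
  proof (cases "\<forall>n. share n \<omega> < x")
    case True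
    then show ?thesis using le by (auto intro: less_imp_le)
  next
    case False
    then obtain n where n: "x \<le> share n \<omega>" by (auto simp: not_less)
    have "share n \<omega> \<le> (SUP n. share n \<omega>)" by (rule cSUP_upper[OF _ bdd_above_share]) auto
    then show ?thesis using False n by auto
  qed
  then have "{\<omega> \<in> space M. (SUP n. share n \<omega>) \<le> x} = ?L \<union> ?A" by auto
  then have "prob {\<omega> \<in> space M. (SUP n. share n \<omega>) \<le> x} = prob ?L + prob ?A"
    using finite_measure_Union[OF L A] by auto
  moreover have "{\<omega> \<in> space M. (SUP n. share n \<omega>) = x} = ?U \<union> ?A" by auto
  then have "prob {\<omega> \<in> space M. (SUP n. share n \<omega>) = x} = prob ?U + prob ?A"
    using finite_measure_Union[OF U A] by auto
  ultimately show ?thesis using prob_SUP_unattained[of x] by simp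
qed

end

theorem proposition5p2:
  fixes M :: "'a measure" and X :: "nat \<Rightarrow> 'a \<Rightarrow> bool" and t :: nat
  assumes "polya_urn M 1 1 1 X"
    and "t \<ge> 2"
  shows "measure M {\<omega> \<in> space M. polya_urn.S 1 1 1 X \<omega> = (real t - 1) / real t} =
           (2 * real t - 3) / real t * gen_harm (1 - 1 / real t)
           - (real t - 2) / real t * gen_harm (1 - 2 / real t)
           - (real t - 2) / (real t - 1)
         \<and> measure M {\<omega> \<in> space M. polya_urn.S 1 1 1 X \<omega> \<le> (real t - 1) / real t} =
           (1 - 1 / real t) * gen_harm (1 - 1 / real t)"
proof -
  interpret standard_urn M X
    using assms(1) by (simp only: standard_urn_def)
  have "1 - 1 / real t = (real t - 1) / real t"
    using assms(2) by (simp add: field_simps)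
  then have "(1 - 1 / real t) * h = (2 * real t - 3) / real t * h - (real t - 2) / real t * h" for h
    unfolding left_diff_distrib[symmetric] diff_divide_distrib[symmetric] by simp
  then show ?thesis
    unfolding S_eq prob_SUP_eq prob_SUP_le[OF assms(2)] prob_always_less[OF assms(2)] by simp
qed

end
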